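(* Consider the network consisting of a single edge $e$ from node $i_e$ to node $j_e$, with a single period ($T=1$), serving a finite set $G_e^I$ of ineligible groups and a single eligible group $g^E$ (all groups travel from $i_e$ to $j_e$). Let $\boldsymbol\lambda=(\lambda_E,\lambda_R,\lambda_I)\in\mathbb{R}_{\ge0}^3$ with $\lambda_R<\lambda_E$, and suppose $S_{C,\boldsymbol\lambda}\ne\emptyset$ and $S_{D,\boldsymbol\lambda}\neq\emptyset$. Suppose that: (1) $h$ is continuous and $\{(y,\tau)\in\mathcal{Y}_{\mathrm{adm}}\times\mathbb{R}: h(y,\tau)\le 0\}$ is bounded; (2) for every $\tau\ge0$ and all $y,\bar y\in\mathcal{Y}_{\mathrm{adm}}$ such that for all $k\in[2]$ the total eligible flows on lane $k$ coincide and $y_{e,k,1}^{g'}=\bar y_{e,k,1}^{g'}$ for all $g'\in G_e^I$, one has $h(y,\tau)=h(\bar y,\tau)$; (3) for every $\tau>0$ and every $(\tau,0)$-DBCP equilibrium $y^\star$, $y_{e,1,1}^{g^E\star}=0$. Moreover, suppose that for some $m_y^I,M_y^I,m_y^E>0$, $M_y^E\in(0,d^{g^E})$ and $M_x\in[0,\tfrac12 d_e)$, the constraint $h(y,\tau)\le0$ enforces $$m_y^E\le y_{e,1,1}^{g^E}\le M_y^E,\qquad m_y^I\le\sum_{g\in G_e^I}y_{e,1,1}^g\le M_y^I,\qquad x_{e,1,1}\le M_x .$$ Then there exist $M_\tau>0$ and $m_\alpha\in(0,1)$ such that $$f_{C,\boldsymbol\lambda}^\star\le f_{D,\boldsymbol\lambda}^\star-(\lambda_E-\lambda_R)(1-m_\alpha)M_\tau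 m_y^E<f_{D,\boldsymbol\lambda}^\star .$$
   Context: The edge $e$ has two lanes $k\in[2]=\{1,2\}$: an express lane ($k=1$, may be tolled) and a toll-free general-purpose lane ($k=2$), both with the same latency function $\ell_e:\mathbb{R}\to\mathbb{R}$, strictly increasing, convex, nonnegative on $\mathbb{R}_{\ge0}$. The set of groups is $G=G_e=G_e^I\sqcup\{g^E\}$. Group $g$ has demand $d^g\ge0$ and value of time $v_1^g>0$; $d_e=\sum_{g\in G}d^g$. Flows. $\mathcal{Y}_{\mathrm{adm}}$ is the set of $y=(y_{e,k,1}^g:k\in[2],g\in G)$ with nonnegative entries and $y_{e,1,1}^g+y_{e,2,1}^g=d^g$ for each $g$. Lane flows: $x_{e,k,1}=\sum_{g\in G}y_{e,k,1}^g$. DBCP (discount-based congestion pricing). A policy is $(\tau,\alpha)$ with toll $\tau\ge0$ and discount $\alpha\in[0,1]$. The feasible set is $\mathcal{Y}_{\mathrm{adm}}$. The cost $c_{e,k,1}^g(y)$ is $v_1^g\ell_e(x_{e,1,1})+\tau$ if $k=1,g\in G_e^I$; $v_1^{g}\ell_e(x_{e,1,1})+(1-\alpha)\tau$ if $k=1,g=g^E$; $v_1^g\ell_e(x_{e,2,1})$ if $k=2$. CBCP (credit-based congestion pricing). A policy is $(\tau,B)$ with toll $\tau\ge0$ and budget $B\ge0$ for group $g^E$. The feasible set is $\{y\in\mathcal{Y}_{\mathrm{adm}}: \tau y_{e,1,1}^{g^E}\le B\}$. The cost $c_{e,k,1}^g(y)$ is $v_1^g\ell_e(x_{e,1,1})+\tau$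 if $k=1,g\in G_e^I$, and $v_1^g\ell_e(x_{e,k,1})$ otherwise. Equilibrium. For either kind of policy, $y^\star$ is an equilibrium if it is feasible and for each $g\in G$ and every feasible $y$: $\sum_{k}(y_{e,k,1}^g-y_{e,k,1}^{g\star})c_{e,k,1}^g(y^\star)\ge0$. Societal costs. $h:\mathcal{Y}_{\mathrm{adm}}\times\mathbb{R}\to\mathbb{R}^{n_c}$ is a given constraint function (inequalities componentwise); "$h(y,\tau)\le0$ enforces a condition" means that every $(y,\tau)$ with $h(y,\tau)\le0$ satisfies it. $f_{C,\boldsymbol\lambda}(y,x,\tau)=\lambda_E\sum_{k}v_1^{g^E}\ell_e(x_{e,k,1})y_{e,k,1}^{g^E}-\lambda_R\sum_{g\in G_e^I}\tau y_{e,1,1}^g+\lambda_I\sum_{k}\sum_{g\in G_e^I}(v_1^g\ell_e(x_{e,k,1})+\mathbf 1\{k=1\}\tau)y_{e,k,1}^g$. $f_{D,\boldsymbol\lambda}(y,x,\tau,\alpha)=\lambda_E\sum_{k}(v_1^{g^E}\ell_e(x_{e,k,1})+\mathbf 1\{k=1\}(1-\alpha)\tau)y_{e,k,1}^{g^E}+\lambda_I\sum_{k}\sum_{g\in G_e^I}(v_1^g\ell_e(x_{e,k,1})+\mathbf 1\{k=1\}\tau)y_{e,k,1}^g-\lambda_R\big((1-\alpha)\tau y_{e,1,1}^{g^E}+\sum_{g\in G_e^I}\tau y_{e,1,1}^g\big)$. $S_{C,\boldsymbol\lambda}$ is the set of $(y,x,\tau,B)$ with $\tau,B\ge0$, $y$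 a $(\tau,B)$-CBCP equilibrium with lane flows $x$, and $h(y,\tau)\le0$; $f_{C,\boldsymbol\lambda}^\star=\inf f_{C,\boldsymbol\lambda}$ over $S_{C,\boldsymbol\lambda}$. $S_{D,\boldsymbol\lambda}$ is the set of $(y,x,\tau,\alpha)$ with $\tau\ge0$, $\alpha\in[0,1]$, $y$ a $(\tau,\alpha)$-DBCP equilibrium with lane flows $x$, and $h(y,\tau)\le0$; $f_{D,\boldsymbol\lambda}^\star=\inf f_{D,\boldsymbol\lambda}$ over $S_{D,\boldsymbol\lambda}$. *)

theory Defs
  imports "HOL-Analysis.Analysis"
begin

text \<open>
  The finite type \<open>'g\<close> is the set of all groups on the edge. One element \<open>gE\<close> is
  the eligible group and \<open>UNIV - {gE}\<close> is the set of ineligible groups. The lanes are the elements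
  \<open>1\<close> (express) and \<open>2\<close> (general purpose) of the numeral type \<open>2\<close>, in which \<open>2 = 0\<close>.
  There is one edge and one period, so a flow \<open>y\<close> has entries \<open>y $ k $ g\<close>. Group data are
  the demand \<open>d\<close>, the value of time \<open>v\<close> and the latency function \<open>l\<close> common to both lanes.
\<close>

type_synonym 'g flow = "real ^ 'g ^ 2"

definition adm_flows :: "('g::finite \<Rightarrow> real) \<Rightarrow> 'g flow set" where
  "adm_flows d = {y. (\<forall>k g. 0 \<le> y $ k $ g) \<and> (\<forall>g. y $ 1 $ g + y $ 2 $ g = d g)}"

definition lane_flows :: "('g::finite) flow \<Rightarrow> real ^ 2" where
  "lane_flows y = (\<chi> k. \<Sum>g\<in>UNIV. y $ k $ g)"

text \<open>
  The costs \<open>c ystar\<close> are frozen at the candidate equilibrium, while each group is compared with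
  every flow of the feasible set \<open>F\<close>.
\<close>

definition equilibrium ::
  "('g::finite) flow set \<Rightarrow> ('g flow \<Rightarrow> 2 \<Rightarrow> 'g \<Rightarrow> real) \<Rightarrow> 'g flow \<Rightarrow> bool" where
  "equilibrium F c ystar \<longleftrightarrow> ystar \<in> F \<and>
     (\<forall>g. \<forall>y\<in>F. (\<Sum>k\<in>UNIV. (y $ k $ g - ystar $ k $ g) * c ystar k g) \<ge> 0)"

definition dbcp_cost ::
  "(real \<Rightarrow> real) \<Rightarrow> ('g::finite \<Rightarrow> real) \<Rightarrow> 'g \<Rightarrow> real \<Rightarrow> real \<Rightarrow> 'g flow \<Rightarrow> 2 \<Rightarrow> 'g \<Rightarrow> real" where
  "dbcp_cost l v gE \<tau> \<alpha> y k g =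
     (if k = 1 then
        (if g = gE then v g * l (lane_flows y $ 1) + (1 - \<alpha>) * \<tau>
         else v g * l (lane_flows y $ 1) + \<tau>)
      else v g * l (lane_flows y $ 2))"

definition dbcp_equilibrium ::
  "(real \<Rightarrow> real) \<Rightarrow> ('g::finite \<Rightarrow> real) \<Rightarrow> ('g \<Rightarrow> real) \<Rightarrow> 'g \<Rightarrow> real \<Rightarrow> real \<Rightarrow> 'g flow \<Rightarrow> bool" where
  "dbcp_equilibrium l d v gE \<tau> \<alpha> y \<longleftrightarrow> equilibrium (adm_flows d) (dbcp_cost l v gE \<tau> \<alpha>) y"

definition cbcp_flows :: "('g::finite \<Rightarrow> real) \<Rightarrow> 'g \<Rightarrow> real \<Rightarrow> real \<Rightarrow> 'g flow set" where
  "cbcp_flows d gE \<tau> B = {y \<in> adm_flows d. \<tau> * y $ 1 $ gE \<le> B}"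

definition cbcp_cost ::
  "(real \<Rightarrow> real) \<Rightarrow> ('g::finite \<Rightarrow> real) \<Rightarrow> 'g \<Rightarrow> real \<Rightarrow> 'g flow \<Rightarrow> 2 \<Rightarrow> 'g \<Rightarrow> real" where
  "cbcp_cost l v gE \<tau> y k g =
     (if k = 1 \<and> g \<noteq> gE then v g * l (lane_flows y $ 1) + \<tau>
      else v g * l (lane_flows y $ k))"

definition cbcp_equilibrium ::
  "(real \<Rightarrow> real) \<Rightarrow> ('g::finite \<Rightarrow> real) \<Rightarrow> ('g \<Rightarrow> real) \<Rightarrow> 'g \<Rightarrow> real \<Rightarrow> real \<Rightarrow> 'g flow \<Rightarrow> bool" where
  "cbcp_equilibrium l d v gE \<tau> B y \<longleftrightarrow>
     equilibrium (cbcp_flows d gE \<tau> B) (cbcp_cost l v gE \<tau>) y"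

definition fC ::
  "(real \<Rightarrow> real) \<Rightarrow> ('g::finite \<Rightarrow> real) \<Rightarrow> 'g \<Rightarrow> real \<Rightarrow> real \<Rightarrow> real
     \<Rightarrow> 'g flow \<Rightarrow> real ^ 2 \<Rightarrow> real \<Rightarrow> real" where
  "fC l v gE lE lR lI y x \<tau> =
     lE * (\<Sum>k\<in>UNIV. v gE * l (x $ k) * y $ k $ gE)
     - lR * (\<Sum>g\<in>UNIV - {gE}. \<tau> * y $ 1 $ g)
     + lI * (\<Sum>k\<in>UNIV. \<Sum>g\<in>UNIV - {gE}.
               (v g * l (x $ k) + of_bool (k = 1) * \<tau>) * y $ k $ g)"

definition fD ::
  "(real \<Rightarrow> real) \<Rightarrow> ('g::finite \<Rightarrow> real) \<Rightarrow> 'g \<Rightarrow> real \<Rightarrow> real \<Rightarrow> real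
     \<Rightarrow> 'g flow \<Rightarrow> real ^ 2 \<Rightarrow> real \<Rightarrow> real \<Rightarrow> real" where
  "fD l v gE lE lR lI y x \<tau> \<alpha> =
     lE * (\<Sum>k\<in>UNIV. (v gE * l (x $ k) + of_bool (k = 1) * (1 - \<alpha>) * \<tau>) * y $ k $ gE)
     + lI * (\<Sum>k\<in>UNIV. \<Sum>g\<in>UNIV - {gE}.
               (v g * l (x $ k) + of_bool (k = 1) * \<tau>) * y $ k $ g)
     - lR * ((1 - \<alpha>) * \<tau> * y $ 1 $ gE + (\<Sum>g\<in>UNIV - {gE}. \<tau> * y $ 1 $ g))"

text \<open>
  The constraint function \<open>h\<close> is total here, but only its values on \<open>adm_flows d \<times> UNIV\<close> are used.
  The order on \<open>real ^ 'c\<close> is componentwise.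
\<close>

definition SC ::
  "(real \<Rightarrow> real) \<Rightarrow> ('g::finite \<Rightarrow> real) \<Rightarrow> ('g \<Rightarrow> real) \<Rightarrow> 'g
     \<Rightarrow> ('g flow \<times> real \<Rightarrow> real ^ ('c::finite)) \<Rightarrow> ('g flow \<times> (real ^ 2) \<times> real \<times> real) set" where
  "SC l d v gE h = {(y, x, \<tau>, B). 0 \<le> \<tau> \<and> 0 \<le> B \<and> cbcp_equilibrium l d v gE \<tau> B y
                      \<and> x = lane_flows y \<and> h (y, \<tau>) \<le> 0}"

definition SD ::
  "(real \<Rightarrow> real) \<Rightarrow> ('g::finite \<Rightarrow> real) \<Rightarrow> ('g \<Rightarrow> real) \<Rightarrow> 'g
     \<Rightarrow> ('g flow \<times> real \<Rightarrow> real ^ ('c::finite)) \<Rightarrow> ('g flow \<times> (real ^ 2) \<times> real \<times> real) set" where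
  "SD l d v gE h = {(y, x, \<tau>, \<alpha>). 0 \<le> \<tau> \<and> 0 \<le> \<alpha> \<and> \<alpha> \<le> 1 \<and> dbcp_equilibrium l d v gE \<tau> \<alpha> y
                      \<and> x = lane_flows y \<and> h (y, \<tau>) \<le> 0}"

text \<open>
  These are infima in the reals, so they are meaningful only for nonempty sets on which the cost is
  bounded below. For nonnegative weights and a latency nonnegative on \<open>{0..}\<close>, bounding the tolls
  with \<open>h (y, \<tau>) \<le> 0\<close> suffices for the lower bound.
\<close>

definition fC_opt ::
  "(real \<Rightarrow> real) \<Rightarrow> ('g::finite \<Rightarrow> real) \<Rightarrow> ('g \<Rightarrow> real) \<Rightarrow> 'g
     \<Rightarrow> ('g flow \<times> real \<Rightarrow> real ^ ('c::finite)) \<Rightarrow> real \<Rightarrow> real \<Rightarrow> real \<Rightarrow> real" where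
  "fC_opt l d v gE h lE lR lI = (INF (y, x, \<tau>, B)\<in>SC l d v gE h. fC l v gE lE lR lI y x \<tau>)"

definition fD_opt ::
  "(real \<Rightarrow> real) \<Rightarrow> ('g::finite \<Rightarrow> real) \<Rightarrow> ('g \<Rightarrow> real) \<Rightarrow> 'g
     \<Rightarrow> ('g flow \<times> real \<Rightarrow> real ^ ('c::finite)) \<Rightarrow> real \<Rightarrow> real \<Rightarrow> real \<Rightarrow> real" where
  "fD_opt l d v gE h lE lR lI = (INF (y, x, \<tau>, \<alpha>)\<in>SD l d v gE h. fD l v gE lE lR lI y x \<tau> \<alpha>)"

end

theory Submission imports Defs begin

text \<open>
  A feasible DBCP equilibrium \<open>y\<close> with toll \<open>\<tau>\<close> and discount \<open>\<alpha>\<close> is also a CBCP equilibrium for the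
  toll \<open>\<tau>\<close> and the budget \<open>\<tau> * y $ 1 $ gE\<close>: the express lane is strictly faster, so eligible users
  spend the whole budget, and the ineligible users face unchanged costs. The CBCP cost is smaller by
  \<open>(lE - lR) * (1 - \<alpha>) * \<tau> * y $ 1 $ gE\<close>. As some eligible users stay on the general purpose lane,
  the discounted toll \<open>(1 - \<alpha>) * \<tau>\<close> is at least the value of the time saved, which is bounded
  below because the express flow is at most \<open>Mx\<close>, less than half of the total demand.
\<close>

lemma adm_flows_nonneg: "y \<in> adm_flows d \<Longrightarrow> 0 \<le> y $ k $ g"
  by (simp add: adm_flows_def)

lemma lane_flows_nonneg: "y \<in> adm_flows d \<Longrightarrow> 0 \<le> lane_flows y $ k"
  by (simp add: lane_flows_def adm_flows_def sum_nonneg)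

lemma lane_flows_add:
  assumes "y \<in> adm_flows d"
  shows "lane_flows y $ 1 + lane_flows y $ 2 = (\<Sum>g\<in>UNIV. d g)"
  using assms by (simp add: lane_flows_def adm_flows_def flip: sum.distrib)

lemma dbcp_equilibrium_adm: "dbcp_equilibrium l d v gE \<tau> \<alpha> y \<Longrightarrow> y \<in> adm_flows d"
  by (simp add: dbcp_equilibrium_def equilibrium_def)

text \<open>Moving the eligible users who remain on lane 2 to the express lane must not pay. As
  \<open>interior\<close> makes their number positive, dividing by it leaves a comparison of the two
  lane costs.\<close>

lemma dbcp_equilibrium_time_saving_le_toll:
  fixes d v :: "'g::finite \<Rightarrow> real"
  assumes eq: "dbcp_equilibrium l d v gE \<tau> \<alpha> y"
    and d_nonneg: "\<forall>g. 0 \<le> d g"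
    and interior: "y $ 1 $ gE < d gE"
  shows "v gE * (l (lane_flows y $ 2) - l (lane_flows y $ 1)) \<le> (1 - \<alpha>) * \<tau>"
proof -
  have split: "y $ 1 $ gE + y $ 2 $ gE = d gE"
    using dbcp_equilibrium_adm[OF eq] by (simp add: adm_flows_def)
  \<comment> \<open>All demand is put on the express lane. Only the component of \<open>gE\<close>
    enters its own inequality, and the costs stay frozen at \<open>y\<close>.\<close>
  define z :: "'g flow" where "z = (\<chi> k g. if k = 1 then d g else 0)"
  have "z \<in> adm_flows d"
    using d_nonneg by (simp add: z_def adm_flows_def)
  then have "0 \<le> (\<Sum>k\<in>UNIV. (z $ k $ gE - y $ k $ gE) * dbcp_cost l v gE \<tau> \<alpha> y k gE)"
    using eq by (simp add: dbcp_equilibrium_def equilibrium_def)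
  also have "\<dots> = (d gE - y $ 1 $ gE) *
      (v gE * l (lane_flows y $ 1) + (1 - \<alpha>) * \<tau> - v gE * l (lane_flows y $ 2))"
    by (simp add: sum_2 z_def dbcp_cost_def split[symmetric] algebra_simps)
  finally show ?thesis
    using interior unfolding zero_le_mult_iff right_diff_distrib[of "v gE"] by linarith
qed

lemma dbcp_equilibrium_imp_cbcp_equilibrium:
  assumes eq: "dbcp_equilibrium l d v gE \<tau> \<alpha> y"
    and "0 < \<tau>" "0 < v gE"
    and faster: "l (lane_flows y $ 1) \<le> l (lane_flows y $ 2)"
  shows "cbcp_equilibrium l d v gE \<tau> (\<tau> * y $ 1 $ gE) y"
  unfolding cbcp_equilibrium_def equilibrium_def
proof (intro conjI allI ballI)
  have adm: "y \<in> adm_flows d"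
    using eq by (rule dbcp_equilibrium_adm)
  then show "y \<in> cbcp_flows d gE \<tau> (\<tau> * y $ 1 $ gE)"
    by (simp add: cbcp_flows_def)
  fix g z
  assume z: "z \<in> cbcp_flows d gE \<tau> (\<tau> * y $ 1 $ gE)"
  \<comment> \<open>Dividing the budget constraint by \<tau> caps the express flow at that of
    \<open>y\<close>, so eligible users can only deviate towards the slower lane.\<close>
  then have z_adm: "z \<in> adm_flows d" and z_le: "z $ 1 $ gE \<le> y $ 1 $ gE"
    using \<open>0 < \<tau>\<close> by (simp_all add: cbcp_flows_def)
  show "0 \<le> (\<Sum>k\<in>UNIV. (z $ k $ g - y $ k $ g) * cbcp_cost l v gE \<tau> y k g)"
  proof (cases "g = gE")
    case True
    have lane2: "z $ 2 $ gE - y $ 2 $ gE = y $ 1 $ gE - z $ 1 $ gE"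
      using adm z_adm by (simp add: adm_flows_def algebra_simps)
    have "0 \<le> (y $ 1 $ gE - z $ 1 $ gE) *
        (v gE * (l (lane_flows y $ 2) - l (lane_flows y $ 1)))"
      using z_le faster \<open>0 < v gE\<close> by simp
    then show ?thesis
      unfolding True sum_2 lane2 by (simp add: cbcp_cost_def algebra_simps)
  next
    case False
    then have "cbcp_cost l v gE \<tau> y k g = dbcp_cost l v gE \<tau> \<alpha> y k g" for k
      using exhaust_2[of k] by (auto simp: cbcp_cost_def dbcp_cost_def)
    then show ?thesis
      using eq z_adm by (simp add: dbcp_equilibrium_def equilibrium_def)
  qed
qed

text \<open>The discounted tolls paid by eligible users enter \<open>fD\<close> as a cost with
  weight \<open>lE\<close> and as revenue with weight \<open>lR\<close>; they are absent from
  \<open>fC\<close>.\<close>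

lemma fC_eq_fD:
  "fC l v gE lE lR lI y x \<tau> =
     fD l v gE lE lR lI y x \<tau> \<alpha> - (lE - lR) * ((1 - \<alpha>) * \<tau> * y $ 1 $ gE)"
  unfolding fC_def fD_def by (simp add: sum_2 algebra_simps)

text \<open>Only the revenue term can be negative, and it is at most the largest toll times the
  total demand.\<close>

lemma fC_lower_bound:
  assumes adm: "y \<in> adm_flows d"
    and l_nonneg: "\<forall>x\<ge>0. 0 \<le> l x"
    and v_pos: "\<forall>g. 0 < v g"
    and weights: "0 \<le> lE" "0 \<le> lR" "0 \<le> lI"
    and "0 \<le> \<tau>" "\<tau> \<le> T"
  shows "- (lR * (T * (\<Sum>g\<in>UNIV. d g))) \<le> fC l v gE lE lR lI y (lane_flows y) \<tau>"
proof -
  have lat: "0 \<le> v g * l (lane_flows y $ k)" for g k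
    using l_nonneg lane_flows_nonneg[OF adm] v_pos by (simp add: less_imp_le)
  have "(\<Sum>g\<in>UNIV - {gE}. \<tau> * y $ 1 $ g) \<le> (\<Sum>g\<in>UNIV. \<tau> * y $ 1 $ g)"
    using \<open>0 \<le> \<tau>\<close> adm_flows_nonneg[OF adm] by (intro sum_mono2) simp_all
  also have "\<dots> = \<tau> * lane_flows y $ 1"
    by (simp add: lane_flows_def sum_distrib_left)
  also have "\<dots> \<le> T * (\<Sum>g\<in>UNIV. d g)"
    using \<open>0 \<le> \<tau>\<close> \<open>\<tau> \<le> T\<close> lane_flows_add[OF adm] lane_flows_nonneg[OF adm, of 1]
      lane_flows_nonneg[OF adm, of 2]
    by (intro mult_mono) simp_all
  finally have revenue: "lR * (\<Sum>g\<in>UNIV - {gE}. \<tau> * y $ 1 $ g) \<le> lR * (T * (\<Sum>g\<in>UNIV. d g))"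
    using weights(2) by (rule mult_left_mono)
  have "0 \<le> lE * (\<Sum>k\<in>UNIV. v gE * l (lane_flows y $ k) * y $ k $ gE)"
    using lat adm_flows_nonneg[OF adm] weights(1) by (simp add: sum_nonneg)
  moreover have "0 \<le> lI * (\<Sum>k\<in>UNIV. \<Sum>g\<in>UNIV - {gE}.
      (v g * l (lane_flows y $ k) + of_bool (k = 1) * \<tau>) * y $ k $ g)"
    using lat adm_flows_nonneg[OF adm] weights(3) \<open>0 \<le> \<tau>\<close> by (simp add: sum_nonneg)
  ultimately show ?thesis
    using revenue unfolding fC_def by linarith
qed

text \<open>A real infimum is below every attained cost only if the costs are bounded below; the
  bounded constraint set supplies a common bound on the tolls.\<close>

lemma bdd_below_fC_SC:
  fixes h :: "'g::finite flow \<times> real \<Rightarrow> real ^ 'c::finite"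
  assumes l_nonneg: "\<forall>x\<ge>0. 0 \<le> l x"
    and v_pos: "\<forall>g. 0 < v g"
    and weights: "0 \<le> lE" "0 \<le> lR" "0 \<le> lI"
    and h_bounded: "bounded {(y, \<tau>). y \<in> adm_flows d \<and> h (y, \<tau>) \<le> 0}"
  shows "bdd_below ((\<lambda>(y, x, \<tau>, B). fC l v gE lE lR lI y x \<tau>) ` SC l d v gE h)"
proof -
  obtain T where T: "norm p \<le> T" if "p \<in> {(y, \<tau>). y \<in> adm_flows d \<and> h (y, \<tau>) \<le> 0}" for p
    using h_bounded unfolding bounded_iff by blast
  show ?thesis
  proof (rule bdd_belowI2)
    fix p assume "p \<in> SC l d v gE h"
    then obtain y \<tau> B where p: "p = (y, lane_flows y, \<tau>, B)" "0 \<le> \<tau>" "h (y, \<tau>) \<le> 0"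
      and "cbcp_equilibrium l d v gE \<tau> B y"
      unfolding SC_def by auto
    then have adm: "y \<in> adm_flows d"
      by (simp add: cbcp_equilibrium_def equilibrium_def cbcp_flows_def)
    have "\<tau> \<le> T"
      using T[of "(y, \<tau>)"] norm_snd_le[of \<tau> y] adm p by simp
    then show "- (lR * (T * (\<Sum>g\<in>UNIV. d g))) \<le> (case p of (y, x, \<tau>, B) \<Rightarrow> fC l v gE lE lR lI y x \<tau>)"
      using fC_lower_bound[OF adm l_nonneg v_pos weights \<open>0 \<le> \<tau>\<close>] p by simp
  qed
qed

theorem proposition5p12:
  fixes l :: "real \<Rightarrow> real"
    and d v :: "'g::finite \<Rightarrow> real"
    and gE :: 'g
    and h :: "'g flow \<times> real \<Rightarrow> real ^ 'c::finite"
    and lE lR lI :: real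
    and myI MyI myE MyE Mx :: real
  assumes l_mono: "strict_mono_on {0..} l"
    and l_convex: "convex_on {0..} l"
    and l_nonneg: "\<forall>x\<ge>0. 0 \<le> l x"
    and d_nonneg: "\<forall>g. 0 \<le> d g"
    and v_pos: "\<forall>g. 0 < v g"
    and weights: "0 \<le> lE" "0 \<le> lR" "0 \<le> lI" "lR < lE"
    and SC_nonempty: "SC l d v gE h \<noteq> {}"
    and SD_nonempty: "SD l d v gE h \<noteq> {}"
    and h_cont: "continuous_on (adm_flows d \<times> UNIV) h"
    and h_bounded: "bounded {(y, \<tau>). y \<in> adm_flows d \<and> h (y, \<tau>) \<le> 0}"
    and h_eligible:
      "\<forall>\<tau>\<ge>0. \<forall>y\<in>adm_flows d. \<forall>y'\<in>adm_flows d.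
         (\<forall>k. y $ k $ gE = y' $ k $ gE \<and> (\<forall>g\<in>UNIV - {gE}. y $ k $ g = y' $ k $ g))
           \<longrightarrow> h (y, \<tau>) = h (y', \<tau>)"
    and no_discount: "\<forall>\<tau>>0. \<forall>y. dbcp_equilibrium l d v gE \<tau> 0 y \<longrightarrow> y $ 1 $ gE = 0"
    and bounds: "0 < myI" "0 < MyI" "0 < myE" "0 < MyE" "MyE < d gE"
      "0 \<le> Mx" "Mx < (\<Sum>g\<in>UNIV. d g) / 2"
    and enforces:
      "\<forall>y\<in>adm_flows d. \<forall>\<tau>. h (y, \<tau>) \<le> 0 \<longrightarrow>
         myE \<le> y $ 1 $ gE \<and> y $ 1 $ gE \<le> MyE \<and>
         myI \<le> (\<Sum>g\<in>UNIV - {gE}. y $ 1 $ g) \<and> (\<Sum>g\<in>UNIV - {gE}. y $ 1 $ g) \<le> MyI \<and>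
         lane_flows y $ 1 \<le> Mx"
  shows "\<exists>M\<tau>>0. \<exists>m\<alpha>\<in>{0<..<1}.
           fC_opt l d v gE h lE lR lI
             \<le> fD_opt l d v gE h lE lR lI - (lE - lR) * (1 - m\<alpha>) * M\<tau> * myE
           \<and> fD_opt l d v gE h lE lR lI - (lE - lR) * (1 - m\<alpha>) * M\<tau> * myE
             < fD_opt l d v gE h lE lR lI"
proof -
  define S where "S = (\<Sum>g\<in>UNIV. d g)"
  \<comment> \<open>This is the least value of the time saved by an eligible user: the express lane
    carries at most \<open>Mx\<close>, the other lane at least \<open>S - Mx\<close>.\<close>
  define \<delta> where "\<delta> = v gE * (l (S - Mx) - l Mx)"
  have "l Mx < l (S - Mx)"
    using bounds(6,7) by (intro strict_mono_onD[OF l_mono]) (simp_all add: S_def)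
  then have \<delta>_pos: "0 < \<delta>"
    using v_pos by (simp add: \<delta>_def)
  note l_le = strict_mono_on_leD[OF l_mono]
  have key: "fC_opt l d v gE h lE lR lI + (lE - lR) * (\<delta> * myE) \<le> fD l v gE lE lR lI y x \<tau> \<alpha>"
    if mem: "(y, x, \<tau>, \<alpha>) \<in> SD l d v gE h" for y x \<tau> \<alpha>
  proof -
    have x: "x = lane_flows y" and \<tau>: "0 \<le> \<tau>" and \<alpha>: "0 \<le> \<alpha>" "\<alpha> \<le> 1" and h: "h (y, \<tau>) \<le> 0"
      and eq: "dbcp_equilibrium l d v gE \<tau> \<alpha> y"
      using mem by (simp_all add: SD_def)
    have adm: "y \<in> adm_flows d"
      using eq by (rule dbcp_equilibrium_adm)
    have yE: "myE \<le> y $ 1 $ gE" "y $ 1 $ gE < d gE" and x1: "lane_flows y $ 1 \<le> Mx"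
      using enforces adm h bounds(5) by force+
    have x2: "S - Mx \<le> lane_flows y $ 2"
      using lane_flows_add[OF adm] x1 by (simp add: S_def)
    have lat: "l (lane_flows y $ 1) \<le> l Mx" "l (S - Mx) \<le> l (lane_flows y $ 2)"
      using x1 x2 lane_flows_nonneg[OF adm] bounds(6,7) by (auto intro!: l_le simp: S_def)
    have "\<delta> \<le> v gE * (l (lane_flows y $ 2) - l (lane_flows y $ 1))"
      unfolding \<delta>_def using lat v_pos by (intro mult_left_mono) (simp_all add: less_imp_le)
    also have "\<dots> \<le> (1 - \<alpha>) * \<tau>"
      using eq d_nonneg yE(2) by (rule dbcp_equilibrium_time_saving_le_toll)
    finally have toll: "\<delta> \<le> (1 - \<alpha>) * \<tau>" .
    \<comment> \<open>A zero toll would force \<delta> to be at most 0.\<close>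
    then have "0 < \<tau>"
      using \<delta>_pos \<tau> by (cases "\<tau> = 0") simp_all
    moreover have "l (lane_flows y $ 1) \<le> l (lane_flows y $ 2)"
      using lat \<open>l Mx < l (S - Mx)\<close> by linarith
    ultimately have "cbcp_equilibrium l d v gE \<tau> (\<tau> * y $ 1 $ gE) y"
      using eq v_pos by (simp add: dbcp_equilibrium_imp_cbcp_equilibrium)
    \<comment> \<open>The constraint carries over because \<open>h\<close> sees only the flow and
      the toll, which are unchanged.\<close>
    then have "(y, x, \<tau>, \<tau> * y $ 1 $ gE) \<in> SC l d v gE h"
      using x h \<tau> yE(1) bounds(3) by (simp add: SC_def)
    then have "fC_opt l d v gE h lE lR lI \<le> fC l v gE lE lR lI y x \<tau>"
      unfolding fC_opt_def
      using cINF_lower[OF bdd_below_fC_SC[OF l_nonneg v_pos weights(1-3) h_bounded]] by fastforce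
    moreover have "(lE - lR) * (\<delta> * myE) \<le> (lE - lR) * ((1 - \<alpha>) * \<tau> * y $ 1 $ gE)"
      using toll yE(1) \<delta>_pos bounds(3) weights(4) by (intro mult_left_mono mult_mono) simp_all
    ultimately show ?thesis
      using fC_eq_fD[of l v gE lE lR lI y x \<tau> \<alpha>] by linarith
  qed
  \<comment> \<open>The gap in \<open>key\<close> is the same at every point of \<open>SD\<close>,
    so it survives the passage to the infimum.\<close>
  have "fC_opt l d v gE h lE lR lI + (lE - lR) * (\<delta> * myE) \<le> fD_opt l d v gE h lE lR lI"
    unfolding fD_opt_def using SD_nonempty key by (intro cINF_greatest) auto
  moreover have "0 < (lE - lR) * (\<delta> * myE)"
    using weights(4) \<delta>_pos bounds(3) by simp
  \<comment> \<open>Only the product of 1 - m\<alpha> and M\<tau> matters. It has to equal \<delta>,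
    so 1/2 and 2 * \<delta> serve as witnesses.\<close>
  moreover have "(lE - lR) * (1 - 1 / 2) * (2 * \<delta>) * myE = (lE - lR) * (\<delta> * myE)"
    by simp
  ultimately show ?thesis
    using \<delta>_pos by (intro exI[of _ "2 * \<delta>"] conjI bexI[of _ "1 / 2"]) (linarith | simp)+
qed

end
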